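(* Let $T>0$, $\alpha\in(0,1)$ and let $u\in C^2([0,T])$ be real-valued. Then for $t\in(0,T]$ $${}_0^{TC}D_t^\alpha u(t)={}_0^{C}D_t^\alpha u(t)-\frac{u'(0)\,t^{1-\alpha}}{\Gamma(2-\alpha)}.$$ In particular, if $u'(0)=0$, then ${}_0^{TC}D_t^\alpha u(t)={}_0^{C}D_t^\alpha u(t)$.
   Context: For $0<\alpha<1$, the Caputo fractional derivative of order $\alpha$ is $${}_0^{C}D_t^\alpha u(t)=\frac{1}{\Gamma(1-\alpha)}\int_0^t u'(s)(t-s)^{-\alpha}\,ds,$$ and the transformative (T-Caputo) derivative of order $\alpha$ is $${}_0^{TC}D_t^\alpha u(t)=\frac{1}{\Gamma(2-\alpha)}\int_0^t u''(s)(t-s)^{1-\alpha}\,ds.$$ Here $\Gamma$ is the Gamma function. *)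

theory Defs
  imports "HOL-Analysis.Analysis"
begin

text \<open>
  Derivatives are taken relative to the domain \<open>S\<close> of the function, hence one-sidedly at
  the endpoints of a compact interval; values outside \<open>S\<close> are irrelevant.
\<close>

definition deriv_on :: "real set \<Rightarrow> (real \<Rightarrow> real) \<Rightarrow> real \<Rightarrow> real" where
  "deriv_on S u s = vector_derivative u (at s within S)"

definition C2_on :: "real set \<Rightarrow> (real \<Rightarrow> real) \<Rightarrow> bool" where
  "C2_on S u \<longleftrightarrow>
     u differentiable_on S \<and>
     deriv_on S u differentiable_on S \<and>
     continuous_on S (deriv_on S (deriv_on S u))"

text \<open>
  In both fractional derivatives \<open>S\<close> is the domain of \<open>u\<close>. Since \<open>0 powr a = 0\<close>, the
  integrand vanishes at \<open>s = t\<close>, which does not affect the integral.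
\<close>

definition caputo_deriv :: "real set \<Rightarrow> real \<Rightarrow> (real \<Rightarrow> real) \<Rightarrow> real \<Rightarrow> real" where
  "caputo_deriv S \<alpha> u t =
     1 / Gamma (1 - \<alpha>) * integral {0..t} (\<lambda>s. deriv_on S u s * (t - s) powr (- \<alpha>))"

definition T_caputo_deriv :: "real set \<Rightarrow> real \<Rightarrow> (real \<Rightarrow> real) \<Rightarrow> real \<Rightarrow> real" where
  "T_caputo_deriv S \<alpha> u t =
     1 / Gamma (2 - \<alpha>) *
       integral {0..t} (\<lambda>s. deriv_on S (deriv_on S u) s * (t - s) powr (1 - \<alpha>))"

end

theory Submission
  imports Defs
begin

text \<open>The identity is integration by parts. With \<open>v\<close> = u' and \<open>w\<close> =
  u'', the kernel (t - s)^(1 - \<alpha>) has s-derivative -(1 - \<alpha>) (t - s)^(-\<alpha>), so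
  moving the derivative from u' to the kernel turns the T-Caputo integral into 1 - \<alpha> times
  the Caputo integral plus boundary terms. As 1 - \<alpha> > 0, the term at s = t vanishes; the one
  at s = 0 gives the correction. Dividing by Gamma(2 - \<alpha>) = (1 - \<alpha>) Gamma(1 -
  \<alpha>) matches the normalizations. \<open>caputo_integration_by_parts\<close> carries the
  analysis.\<close>

lemma caputo_integration_by_parts:
  fixes t \<alpha> :: real and v w :: "real \<Rightarrow> real"
  assumes "\<alpha> < 1" and "0 \<le> t"
    and cont_v: "continuous_on {0..t} v" and cont_w: "continuous_on {0..t} w"
    and deriv: "\<And>s. s \<in> {0<..<t} \<Longrightarrow> (v has_real_derivative w s) (at s)"
  shows "(1 - \<alpha>) * integral {0..t} (\<lambda>s. v s * (t - s) powr (- \<alpha>)) =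
           integral {0..t} (\<lambda>s. w s * (t - s) powr (1 - \<alpha>)) + v 0 * t powr (1 - \<alpha>)"
proof -
  define F where "F s = v s * (t - s) powr (1 - \<alpha>)" for s
  define g where "g s = w s * (t - s) powr (1 - \<alpha>)" for s
  define h where "h s = v s * (t - s) powr (- \<alpha>)" for s
  have cont_powr: "continuous_on {0..t} (\<lambda>s. (t - s) powr (1 - \<alpha>))"
    using \<open>\<alpha> < 1\<close> by (intro continuous_on_powr' continuous_intros) auto
  have g: "(g has_integral integral {0..t} g) {0..t}"
    unfolding g_def
    by (intro integrable_integral integrable_continuous_real continuous_on_mult cont_w cont_powr)
  \<comment> \<open>\<open>h\<close> may blow up near s = t, but \<open>F\<close> stays continuous
    there, and the fundamental theorem asks for its derivative only in the open interval.
    Integrability of the singular integrand is thus a conclusion.\<close>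
  have "((\<lambda>s. g s - (1 - \<alpha>) * h s) has_integral (F t - F 0)) {0..t}"
  proof (rule fundamental_theorem_of_calculus_interior)
    show "continuous_on {0..t} F"
      unfolding F_def by (intro continuous_on_mult cont_v cont_powr)
    fix s assume s: "s \<in> {0<..<t}"
    have "((\<lambda>s. (t - s) powr (1 - \<alpha>)) has_real_derivative - ((1 - \<alpha>) * (t - s) powr (- \<alpha>))) (at s)"
      using s by (auto intro!: derivative_eq_intros)
    from DERIV_mult[OF deriv[OF s] this]
    show "(F has_vector_derivative g s - (1 - \<alpha>) * h s) (at s)"
      unfolding F_def g_def h_def has_real_derivative_iff_has_vector_derivative[symmetric]
      by (simp add: algebra_simps)
  qed (rule \<open>0 \<le> t\<close>)
  \<comment> \<open>Subtracting from the continuous \<open>g\<close> isolates the singular part,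
    with no separate improper-integral argument.\<close>
  from has_integral_diff[OF g this]
  have "((\<lambda>s. (1 - \<alpha>) * h s) has_integral (integral {0..t} g - (F t - F 0))) {0..t}"
    by simp
  from integral_unique[OF this]
  have "(1 - \<alpha>) * integral {0..t} h = integral {0..t} g - (F t - F 0)"
    unfolding integral_mult_right .
  \<comment> \<open>\<open>F t\<close> is 0 because \<open>0 powr (1 - \<alpha>) = 0\<close>, so
    only \<open>F 0\<close> survives.\<close>
  then show ?thesis
    unfolding g_def[abs_def] h_def[abs_def] by (simp add: F_def)
qed

text \<open>Links the domain-relative derivative to the two-sided one that integration by parts
  uses: away from the boundary the two filters agree.\<close>

lemma has_real_derivative_deriv_on:
  assumes "f differentiable_on S" and "s \<in> interior S"
  shows "(f has_real_derivative deriv_on S f s) (at s)"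
proof -
  have "s \<in> S" using assms(2) interior_subset by blast
  then have "f differentiable (at s within S)"
    using assms(1) by (simp add: differentiable_on_def)
  then have "(f has_vector_derivative deriv_on S f s) (at s within S)"
    unfolding deriv_on_def by (simp add: vector_derivative_works)
  then show ?thesis
    unfolding at_within_interior[OF assms(2)] has_real_derivative_iff_has_vector_derivative .
qed

theorem lemma2:
  fixes T \<alpha> t :: real and u :: "real \<Rightarrow> real"
  assumes "T > 0"
    and "0 < \<alpha>" and "\<alpha> < 1"
    and "C2_on {0..T} u"
    and "t \<in> {0<..T}"
  shows "T_caputo_deriv {0..T} \<alpha> u t =
           caputo_deriv {0..T} \<alpha> u t
             - deriv_on {0..T} u 0 * t powr (1 - \<alpha>) / Gamma (2 - \<alpha>) \<and>
         (deriv_on {0..T} u 0 = 0 \<longrightarrow>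
           T_caputo_deriv {0..T} \<alpha> u t = caputo_deriv {0..T} \<alpha> u t)"
proof -
  define v where "v = deriv_on {0..T} u"
  define w where "w = deriv_on {0..T} v"
  have v: "v differentiable_on {0..T}" and w: "continuous_on {0..T} w"
    using \<open>C2_on {0..T} u\<close> by (auto simp: C2_on_def v_def w_def)
  have sub: "{0..t} \<subseteq> {0..T}" using \<open>t \<in> {0<..T}\<close> by auto
  have parts: "(1 - \<alpha>) * integral {0..t} (\<lambda>s. v s * (t - s) powr (- \<alpha>)) =
      integral {0..t} (\<lambda>s. w s * (t - s) powr (1 - \<alpha>)) + v 0 * t powr (1 - \<alpha>)"
  proof (rule caputo_integration_by_parts)
    show "continuous_on {0..t} v" "continuous_on {0..t} w"
      using differentiable_imp_continuous_on[OF v] w sub by (auto intro: continuous_on_subset)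
    show "(v has_real_derivative w s) (at s)" if "s \<in> {0<..<t}" for s
      unfolding w_def using that \<open>t \<in> {0<..T}\<close>
      by (intro has_real_derivative_deriv_on v) auto
  qed (use assms in auto)
  \<comment> \<open>Being positive, 1 - \<alpha> is not a pole of Gamma, so the functional equation
    applies.\<close>
  have "1 - \<alpha> \<notin> \<int>\<^sub>\<le>\<^sub>0"
    using \<open>\<alpha> < 1\<close> by (auto elim!: nonpos_Ints_cases)
  then have Gamma: "Gamma (2 - \<alpha>) = (1 - \<alpha>) * Gamma (1 - \<alpha>)"
    using Gamma_plus1[of "1 - \<alpha>"] by simp
  have "T_caputo_deriv {0..T} \<alpha> u t =
      ((1 - \<alpha>) * integral {0..t} (\<lambda>s. v s * (t - s) powr (- \<alpha>)) - v 0 * t powr (1 - \<alpha>))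
        / Gamma (2 - \<alpha>)"
    unfolding parts T_caputo_deriv_def v_def[symmetric] w_def[symmetric] by simp
  also have "\<dots> = caputo_deriv {0..T} \<alpha> u t - v 0 * t powr (1 - \<alpha>) / Gamma (2 - \<alpha>)"
    unfolding caputo_deriv_def v_def[symmetric] using \<open>\<alpha> < 1\<close> by (simp add: Gamma diff_divide_distrib)
  finally have "T_caputo_deriv {0..T} \<alpha> u t =
      caputo_deriv {0..T} \<alpha> u t - v 0 * t powr (1 - \<alpha>) / Gamma (2 - \<alpha>)" .
  then show ?thesis
    by (simp add: v_def)
qed

end
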